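(* Let $G$ be a graph with $n$ vertices and $m$ edges, let $\rho_1,\dots,\rho_n$ be the eigenvalues of its Randić adjacency matrix $R(G)$, and let $I_R^1(G)$, $I_\alpha^2(G)$, $I_\alpha^3(G)$ be the generalized graph entropies formed from $\rho_1,\dots,\rho_n$. Then for $\alpha\ne1$: (i) $I_R^1(G)=1-\frac{2}{RE^2(G)}R_{-1}(G)$; (ii) $I_\alpha^2(G)=\frac{1}{1-\alpha}\log\frac{M_\alpha^*}{RE^\alpha(G)}$; (iii) $I_\alpha^3(G)=\frac{1}{2^{1-\alpha}-1}\left(\frac{M_\alpha^*}{RE^\alpha(G)}-1\right)$, where $RE(G)$ is the Randić energy of $G$, $RE^\alpha(G)=(RE(G))^\alpha$, $R_{-1}(G)$ is the general Randić index $R_\beta(G)$ of $G$ with $\beta=-1$, and $M_\alpha^*=\sum_{i=1}^n|\rho_i|^\alpha$.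
   Context: Graphs are simple, with vertices $v_1,\dots,v_n$ of degrees $d_1,\dots,d_n$. The Randić adjacency matrix is $R(G)=[r_{ij}]$ with $r_{ij}=\frac{1}{\sqrt{d_id_j}}$ if $v_i$ and $v_j$ are adjacent, and $r_{ij}=0$ otherwise. The Randić energy is $RE(G)=\sum_{i=1}^n|\rho_i|$. The general Randić index is $R_\beta(G)=\sum_{i\sim j}(d_id_j)^\beta$, the sum over all edges $v_iv_j$ (each counted once). For numbers $\mu_1,\dots,\mu_n$ (listed with multiplicity), put $p_i=|\mu_i|/\sum_{j=1}^n|\mu_j|$. The generalized graph entropies formed from $\mu_1,\dots,\mu_n$ are $I^1=\sum_{i=1}^n p_i(1-p_i)$, $\quad I^2_\alpha=\frac{1}{1-\alpha}\log\left(\sum_{i=1}^n p_i^\alpha\right)$, $\quad I^3_\alpha=\frac{\sum_{i=1}^n p_i^\alpha-1}{2^{1-\alpha}-1}$ for $\alpha\ne1$, where $\log$ is the logarithm to a fixed base. The subscript on $I^1$ names the matrix used. *)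

theory Defs
  imports Complex_Main "Graph_Theory.Digraph" "Jordan_Normal_Form.Char_Poly"
begin

text \<open>
  A simple graph is a \<^locale>\<open>graph\<close>: finite, loop-free, without parallel arcs and symmetric, so
  each undirected edge is a pair of opposite arcs. Hence the degree of a vertex is its out-degree,
  and an edge is the two-element set of its end vertices.
\<close>

definition undirected_edges :: "('a, 'b) pre_digraph \<Rightarrow> 'a set set" where
  "undirected_edges G = {{u, v} | u v. u \<rightarrow>\<^bsub>G\<^esub> v}"

text \<open>The list \<open>vs\<close> is an enumeration \<open>v\<^sub>1, \<dots>, v\<^sub>n\<close> of the vertices, with indices starting at 0.\<close>

definition randic_matrix :: "('a, 'b) pre_digraph \<Rightarrow> 'a list \<Rightarrow> real mat" where
  "randic_matrix G vs = mat (length vs) (length vs) (\<lambda>(i, j).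
     if vs ! i \<rightarrow>\<^bsub>G\<^esub> vs ! j
     then 1 / sqrt (real (out_degree G (vs ! i)) * real (out_degree G (vs ! j)))
     else 0)"

text \<open>
  The eigenvalues with their algebraic multiplicities. The matrix is real symmetric, so its
  characteristic polynomial splits over the reals and no eigenvalue is lost by taking real roots.
\<close>

definition randic_spectrum :: "('a, 'b) pre_digraph \<Rightarrow> 'a list \<Rightarrow> real multiset" where
  "randic_spectrum G vs = proots (char_poly (randic_matrix G vs))"

definition randic_energy :: "('a, 'b) pre_digraph \<Rightarrow> 'a list \<Rightarrow> real" where
  "randic_energy G vs = (\<Sum>\<rho>\<in>#randic_spectrum G vs. \<bar>\<rho>\<bar>)"

text \<open>For an edge \<open>e = {u, v}\<close> the product over \<open>e\<close> is \<open>d\<^sub>u d\<^sub>v\<close>, because \<open>u \<noteq> v\<close>.\<close>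

definition general_randic_index :: "real \<Rightarrow> ('a, 'b) pre_digraph \<Rightarrow> real" where
  "general_randic_index \<beta> G =
     (\<Sum>e\<in>undirected_edges G. (\<Prod>v\<in>e. real (out_degree G v)) powr \<beta>)"

text \<open>
  The weights \<open>p\<^sub>i\<close> of the numbers in \<open>M\<close>, with multiplicity. They are meaningful only when the
  numbers are not all zero (otherwise the division by zero makes every weight zero).
\<close>

definition entropy_weights :: "real multiset \<Rightarrow> real multiset" where
  "entropy_weights M = image_mset (\<lambda>\<mu>. \<bar>\<mu>\<bar> / (\<Sum>\<nu>\<in>#M. \<bar>\<nu>\<bar>)) M"

definition entropy1 :: "real multiset \<Rightarrow> real" where
  "entropy1 M = (\<Sum>p\<in>#entropy_weights M. p * (1 - p))"

text \<open>
  Powers with a real exponent are \<open>powr\<close>, so \<open>0 powr \<alpha> = 0\<close> for every \<open>\<alpha>\<close>: for \<open>\<alpha> \<le> 0\<close>, sums of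
  powers range over the nonzero numbers only. The argument \<open>b\<close> is the base of the logarithm.
\<close>

definition entropy2 :: "real \<Rightarrow> real \<Rightarrow> real multiset \<Rightarrow> real" where
  "entropy2 b \<alpha> M = 1 / (1 - \<alpha>) * log b (\<Sum>p\<in>#entropy_weights M. p powr \<alpha>)"

definition entropy3 :: "real \<Rightarrow> real multiset \<Rightarrow> real" where
  "entropy3 \<alpha> M = ((\<Sum>p\<in>#entropy_weights M. p powr \<alpha>) - 1) / (2 powr (1 - \<alpha>) - 1)"

definition randic_moment :: "real \<Rightarrow> ('a, 'b) pre_digraph \<Rightarrow> 'a list \<Rightarrow> real" where
  "randic_moment \<alpha> G vs = (\<Sum>\<rho>\<in>#randic_spectrum G vs. \<bar>\<rho>\<bar> powr \<alpha>)"

end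

theory Submission
  imports Defs "Jordan_Normal_Form.Schur_Decomposition"
begin

text \<open>
  Parts (ii) and (iii) only say that the common denominator of the weights
  \<open>p\<^sub>i = \<bar>\<rho>\<^sub>i\<bar> / RE(G)\<close> can be pulled out of \<open>\<Sum> p\<^sub>i\<^sup>\<alpha>\<close> (lemma \<open>sum_entropy_weights_powr\<close>). In
  part (i), the weights sum to 1, so the entropy is \<open>1 - \<Sum> p\<^sub>i\<^sup>2 = 1 - (\<Sum> \<rho>\<^sub>i\<^sup>2) / RE(G)\<^sup>2\<close>
  (lemma \<open>entropy1_eq_sum_squares\<close>), and two facts remain: \<open>\<Sum> \<rho>\<^sub>i\<^sup>2 = 2 R\<^sub>-\<^sub>1(G)\<close> and \<open>RE(G) \<noteq> 0\<close>.

  The sum of the squared eigenvalues is the trace of \<open>R(G)\<^sup>2\<close>, which for a symmetric matrix is the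
  sum of the squared entries (lemma \<open>sum_squares_proots_symmetric\<close>). The spectrum consists of the
  real roots of the characteristic polynomial only. A real symmetric matrix has no other roots,
  since all its complex eigenvalues are real; so the polynomial splits over the reals, a real Schur
  decomposition turns the matrix into a similar triangular one, and the trace of the square can be
  read off the diagonal.

  The squared entry of \<open>R(G)\<close> at adjacent \<open>u\<close> and \<open>v\<close> is \<open>1 / (d\<^sub>u d\<^sub>v)\<close>, and every edge occurs at
  two positions, which gives \<open>2 R\<^sub>-\<^sub>1(G)\<close> (lemma \<open>sum_squares_randic_spectrum\<close>). If there is an edge,
  this number is positive, so some eigenvalue is nonzero and so is the energy.
\<close>

section \<open>Entropies of a multiset of numbers\<close>

lemma entropy1_eq_sum_squares:
  assumes "(\<Sum>\<mu>\<in>#M. \<bar>\<mu>\<bar>) \<noteq> 0"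
  shows "entropy1 M = 1 - (\<Sum>\<mu>\<in>#M. \<mu>\<^sup>2) / (\<Sum>\<mu>\<in>#M. \<bar>\<mu>\<bar>)\<^sup>2"
proof -
  define S where "S = (\<Sum>\<mu>\<in>#M. \<bar>\<mu>\<bar>)"
  have *: "(\<Sum>\<mu>\<in>#N. \<bar>\<mu>\<bar> / S * (1 - \<bar>\<mu>\<bar> / S))
      = (\<Sum>\<mu>\<in>#N. \<bar>\<mu>\<bar>) / S - (\<Sum>\<mu>\<in>#N. \<mu>\<^sup>2) / S\<^sup>2" for N
  proof (induction N)
    case (add \<mu> N)
    have "\<bar>\<mu>\<bar> / S * (1 - \<bar>\<mu>\<bar> / S) = \<bar>\<mu>\<bar> / S - \<mu>\<^sup>2 / S\<^sup>2"
      by (simp add: right_diff_distrib power2_eq_square)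
    with add show ?case
      by (simp add: add_divide_distrib)
  qed simp
  have "entropy1 M = (\<Sum>\<mu>\<in>#M. \<bar>\<mu>\<bar> / S * (1 - \<bar>\<mu>\<bar> / S))"
    by (simp add: entropy1_def entropy_weights_def S_def image_mset.compositionality o_def)
  also have "\<dots> = 1 - (\<Sum>\<mu>\<in>#M. \<mu>\<^sup>2) / S\<^sup>2"
    unfolding * using assms by (simp flip: S_def)
  finally show ?thesis
    by (simp add: S_def)
qed

lemma sum_entropy_weights_powr:
  "(\<Sum>p\<in>#entropy_weights M. p powr \<alpha>)
     = (\<Sum>\<mu>\<in>#M. \<bar>\<mu>\<bar> powr \<alpha>) / (\<Sum>\<mu>\<in>#M. \<bar>\<mu>\<bar>) powr \<alpha>"
proof -
  define S where "S = (\<Sum>\<mu>\<in>#M. \<bar>\<mu>\<bar>)"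
  have "0 \<le> S"
    unfolding S_def by (induction M) auto
  then have "(\<Sum>\<mu>\<in>#N. (\<bar>\<mu>\<bar> / S) powr \<alpha>) = (\<Sum>\<mu>\<in>#N. \<bar>\<mu>\<bar> powr \<alpha>) / S powr \<alpha>" for N
    by (induction N) (simp_all add: powr_divide add_divide_distrib)
  then show ?thesis
    by (simp add: entropy_weights_def S_def image_mset.compositionality o_def)
qed

lemma sum_mset_abs_eq_0_iff:
  "(\<Sum>\<mu>\<in>#M. \<bar>\<mu>\<bar>) = 0 \<longleftrightarrow> (\<forall>\<mu>\<in>#M. \<mu> = 0)" for M :: "real multiset"
proof (induction M)
  case (add \<mu> M)
  have "0 \<le> (\<Sum>\<nu>\<in>#M. \<bar>\<nu>\<bar>)"
    by (induction M) auto
  with add show ?case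
    by (auto simp: add_nonneg_eq_0_iff)
qed simp

section \<open>Trace\<close>

definition mat_trace :: "'a::comm_ring_1 mat \<Rightarrow> 'a" where
  "mat_trace A = (\<Sum>i<dim_row A. A $$ (i, i))"

lemma mat_trace_mult:
  assumes "A \<in> carrier_mat n m" and "B \<in> carrier_mat m n"
  shows "mat_trace (A * B) = (\<Sum>i<n. \<Sum>j<m. A $$ (i, j) * B $$ (j, i))"
  using assms by (auto simp: mat_trace_def scalar_prod_def atLeast0LessThan intro!: sum.cong)

lemma mat_trace_mult_commute:
  assumes "A \<in> carrier_mat n m" and "B \<in> carrier_mat m n"
  shows "mat_trace (A * B) = mat_trace (B * A)"
  unfolding mat_trace_mult[OF assms] mat_trace_mult[OF assms(2,1)]
  by (subst sum.swap) (simp add: mult.commute)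

lemma mat_trace_square_similar:
  assumes A: "A \<in> carrier_mat n n" and sim: "similar_mat_wit A B P Q"
  shows "mat_trace (A * A) = mat_trace (B * B)"
proof -
  note D = similar_mat_witD2[OF A sim]
  have B: "B \<in> carrier_mat n n" and P: "P \<in> carrier_mat n n" and Q: "Q \<in> carrier_mat n n"
    using D by auto
  have BB: "B * B \<in> carrier_mat n n" and BBQ: "B * B * Q \<in> carrier_mat n n"
    using B Q by auto
  have "A * A = P * (B * Q) * (P * (B * Q))"
    using D(3) B P Q by simp
  also have "\<dots> = P * (B * ((Q * P) * (B * Q)))"
    using B P Q by (simp add: assoc_mult_mat[of _ n n _ n _ n])
  also have "\<dots> = P * (B * B * Q)"
    using B Q by (simp add: D(2) assoc_mult_mat[of _ n n _ n _ n])
  finally have "mat_trace (A * A) = mat_trace (B * B * Q * P)"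
    using mat_trace_mult_commute[OF P BBQ] by simp
  also have "B * B * Q * P = B * B"
    using assoc_mult_mat[OF BB Q P] D(2) right_mult_one_mat[OF BB] by simp
  finally show ?thesis .
qed

lemma mat_trace_square_upper_triangular:
  assumes B: "B \<in> carrier_mat n n" and ut: "upper_triangular B"
  shows "mat_trace (B * B) = (\<Sum>e\<leftarrow>diag_mat B. e\<^sup>2)"
proof -
  \<comment> \<open>For \<open>i \<noteq> j\<close> one of the entries at \<open>(i, j)\<close> and \<open>(j, i)\<close> lies below the diagonal.\<close>
  have "B $$ (i, j) * B $$ (j, i) = (if j = i then (B $$ (i, i))\<^sup>2 else 0)"
    if "i < n" "j < n" for i j
    using that B upper_triangularD[OF ut, of i j] upper_triangularD[OF ut, of j i]
    by (cases i j rule: linorder_cases) (auto simp: power2_eq_square)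
  then have "mat_trace (B * B) = (\<Sum>i<n. \<Sum>j<n. if j = i then (B $$ (i, i))\<^sup>2 else 0)"
    unfolding mat_trace_mult[OF B B] by (intro sum.cong refl) auto
  also have "\<dots> = (\<Sum>i<n. (B $$ (i, i))\<^sup>2)"
    by simp
  also have "\<dots> = (\<Sum>e\<leftarrow>diag_mat B. e\<^sup>2)"
    using B by (simp add: diag_mat_def o_def interv_sum_list_conv_sum_set_nat atLeast0LessThan)
  finally show ?thesis .
qed

section \<open>Spectrum of a real symmetric matrix\<close>

text \<open>
  If \<open>A v = k v\<close>, then \<open>\<Sum> cnj v\<^sub>i A\<^sub>i\<^sub>j v\<^sub>j = k \<bar>v\<bar>\<^sup>2\<close>. Conjugation only exchanges the roles of \<open>i\<close>
  and \<open>j\<close> in this sum, so by symmetry the sum is real, and hence \<open>k\<close> is.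
\<close>

lemma eigenvalue_of_real_symmetric_real:
  fixes A :: "real mat"
  assumes A: "A \<in> carrier_mat n n"
    and sym: "\<And>i j. i < n \<Longrightarrow> j < n \<Longrightarrow> A $$ (i, j) = A $$ (j, i)"
    and ev: "eigenvalue (map_mat complex_of_real A) k"
  shows "k \<in> \<real>"
proof -
  from ev obtain v where v: "v \<in> carrier_vec n" "v \<noteq> 0\<^sub>v n"
    and Av: "map_mat complex_of_real A *\<^sub>v v = k \<cdot>\<^sub>v v"
    using A unfolding eigenvalue_def eigenvector_def by auto
  have Av_i: "(\<Sum>j<n. of_real (A $$ (i, j)) * v $ j) = k * v $ i" if "i < n" for i
    using arg_cong[OF Av, of "\<lambda>w. w $ i"] that A v
    by (simp add: scalar_prod_def atLeast0LessThan)
  define s where "s = (\<Sum>i<n. \<Sum>j<n. cnj (v $ i) * (of_real (A $$ (i, j)) * v $ j))"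
  define q where "q = (\<Sum>i<n. (cmod (v $ i))\<^sup>2)"
  have "cnj s = (\<Sum>i<n. \<Sum>j<n. v $ i * (of_real (A $$ (i, j)) * cnj (v $ j)))"
    by (simp add: s_def)
  also have "\<dots> = (\<Sum>j<n. \<Sum>i<n. v $ i * (of_real (A $$ (i, j)) * cnj (v $ j)))"
    by (rule sum.swap)
  also have "\<dots> = s"
    unfolding s_def using sym by (intro sum.cong refl) (simp add: mult_ac)
  finally have "s \<in> \<real>"
    by (simp add: Reals_cnj_iff)
  moreover have "s = k * of_real q"
  proof -
    have "s = (\<Sum>i<n. cnj (v $ i) * (k * v $ i))"
      unfolding s_def sum_distrib_left[symmetric] by (intro sum.cong refl) (simp add: Av_i)
    also have "\<dots> = (\<Sum>i<n. k * of_real ((cmod (v $ i))\<^sup>2))"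
      by (intro sum.cong refl) (subst complex_norm_square, simp)
    finally show ?thesis
      by (simp add: q_def sum_distrib_left)
  qed
  moreover have "q \<noteq> 0"
  proof
    assume "q = 0"
    then have "\<forall>i<n. v $ i = 0"
      by (auto simp: q_def sum_nonneg_eq_0_iff)
    with v show False
      by auto
  qed
  ultimately have "k = s / complex_of_real q"
    by simp
  also have "\<dots> \<in> \<real>"
    using \<open>s \<in> \<real>\<close> by (intro Reals_divide) simp_all
  finally show ?thesis .
qed

text \<open>
  Over the complex numbers the polynomial has linear factors, all with real roots. The product of
  the same factors over the reals has the same image under the injective inclusion of coefficients.
\<close>

lemma char_poly_symmetric_splits:
  fixes A :: "real mat"
  assumes A: "A \<in> carrier_mat n n"
    and sym: "\<And>i j. i < n \<Longrightarrow> j < n \<Longrightarrow> A $$ (i, j) = A $$ (j, i)"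
  obtains es where "char_poly A = (\<Prod>e\<leftarrow>es. [:- e, 1:])"
proof -
  let ?C = "map_mat complex_of_real A"
  have C: "?C \<in> carrier_mat n n"
    using A by simp
  from char_poly_factorized[OF C] obtain as
    where as: "char_poly ?C = (\<Prod>a\<leftarrow>as. [:- a, 1:])" by blast
  interpret of_real_poly_hom: map_poly_inj_idom_hom complex_of_real ..
  have real: "a \<in> \<real>" if "a \<in> set as" for a
  proof -
    have "poly (char_poly ?C) a = 0"
      using that unfolding as by (auto simp: poly_prod_list o_def)
    then show ?thesis
      using eigenvalue_of_real_symmetric_real[OF A sym] eigenvalue_root_char_poly[OF C] by blast
  qed
  have "map_poly complex_of_real (char_poly A) = char_poly ?C"
    by (rule of_real_hom.char_poly_hom[OF A, symmetric])
  also have "\<dots> = map_poly complex_of_real (\<Prod>e\<leftarrow>map Re as. [:- e, 1:])"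
    unfolding as using real
  proof (induction as)
    case (Cons a as)
    then have "complex_of_real (Re a) = a"
      by simp
    with Cons show ?case
      by (simp add: of_real_poly_hom.hom_mult of_real_hom.map_poly_pCons_hom del: mult_pCons_left)
  qed simp
  finally have "char_poly A = (\<Prod>e\<leftarrow>map Re as. [:- e, 1:])"
    by (rule of_real_poly_hom.injectivity)
  then show thesis
    by (rule that)
qed

lemma proots_prod_linear_factors: "proots (\<Prod>e\<leftarrow>es. [:- e, 1:]) = mset es"
  for es :: "'a::idom list"
proof (induction es)
  case (Cons e es)
  have "(\<Prod>e\<leftarrow>es. [:- e, 1:]) \<noteq> 0"
    by auto
  with Cons show ?case
    by (simp add: proots_mult del: mult_pCons_left)
qed simp

lemma sum_squares_proots_symmetric:
  fixes A :: "real mat"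
  assumes A: "A \<in> carrier_mat n n"
    and sym: "\<And>i j. i < n \<Longrightarrow> j < n \<Longrightarrow> A $$ (i, j) = A $$ (j, i)"
  shows "(\<Sum>e\<in>#proots (char_poly A). e\<^sup>2) = (\<Sum>i<n. \<Sum>j<n. (A $$ (i, j))\<^sup>2)"
proof -
  from char_poly_symmetric_splits[OF A sym] obtain es
    where es: "char_poly A = (\<Prod>e\<leftarrow>es. [:- e, 1:])" by blast
  obtain B P Q where "schur_decomposition A es = (B, P, Q)"
    by (cases "schur_decomposition A es") auto
  from schur_decomposition[OF A es this]
  have sim: "similar_mat_wit A B P Q" and ut: "upper_triangular B" and diag: "diag_mat B = es"
    by auto
  have B: "B \<in> carrier_mat n n"
    using similar_mat_witD2[OF A sim] by simp
  have "(\<Sum>e\<in>#proots (char_poly A). e\<^sup>2) = (\<Sum>e\<leftarrow>es. e\<^sup>2)"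
    unfolding es proots_prod_linear_factors by (simp flip: sum_mset_sum_list)
  also have "\<dots> = mat_trace (A * A)"
    using mat_trace_square_similar[OF A sim] mat_trace_square_upper_triangular[OF B ut] diag
    by simp
  also have "\<dots> = (\<Sum>i<n. \<Sum>j<n. (A $$ (i, j))\<^sup>2)"
    unfolding mat_trace_mult[OF A A] using sym
    by (intro sum.cong refl) (auto simp: power2_eq_square)
  finally show ?thesis .
qed

section \<open>Sums over arcs and edges\<close>

lemma sum_nth_nth_eq_sum_pairs:
  assumes "distinct vs"
  shows "(\<Sum>i<length vs. \<Sum>j<length vs. f (vs ! i) (vs ! j)) = (\<Sum>(u, v)\<in>set vs \<times> set vs. f u v)"
proof -
  have "(\<Sum>i<length vs. g (vs ! i)) = (\<Sum>u\<in>set vs. g u)" for g :: "'a \<Rightarrow> 'b"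
    using sum.reindex_bij_betw[OF bij_betw_nth[OF assms refl refl], of g] .
  then show ?thesis
    by (simp flip: sum.cartesian_product)
qed

context graph
begin

lemma finite_arcs_ends: "finite (arcs_ends G)"
  by (simp add: arcs_ends_def)

lemma out_degree_pos:
  assumes "u \<rightarrow>\<^bsub>G\<^esub> v"
  shows "0 < out_degree G u"
proof -
  from assms obtain a where "a \<in> out_arcs G u"
    by (auto simp: arcs_ends_conv)
  then show ?thesis
    unfolding out_degree_def by (subst card_gt_0_iff) (use finite_out_arcs in auto)
qed

text \<open>Two opposite arcs lie over each edge, and they are distinct because there are no loops.\<close>

lemma sum_arcs_ends_eq_sum_edges:
  fixes g :: "'a set \<Rightarrow> real"
  shows "(\<Sum>(u, v)\<in>arcs_ends G. g {u, v}) = 2 * (\<Sum>e\<in>undirected_edges G. g e)"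
proof -
  let ?edge = "\<lambda>(u, v). {u, v}"
  have edges: "undirected_edges G = ?edge ` arcs_ends G"
    by (auto simp: undirected_edges_def)
  have fibre: "(\<Sum>p\<in>{p \<in> arcs_ends G. ?edge p = e}. g (?edge p)) = 2 * g e"
    if "e \<in> undirected_edges G" for e
  proof -
    from that obtain u v where uv: "u \<rightarrow>\<^bsub>G\<^esub> v" and e: "e = {u, v}"
      by (auto simp: undirected_edges_def)
    have "u \<noteq> v"
      using uv adj_not_same by auto
    moreover have "{p \<in> arcs_ends G. ?edge p = e} = {(u, v), (v, u)}"
    proof (rule equalityI; rule subsetI)
      fix p
      assume "p \<in> {(u, v), (v, u)}"
      then show "p \<in> {p \<in> arcs_ends G. ?edge p = e}"
        using uv arcs_ends_symmetric[OF sym_arcs uv] by (auto simp: e)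
    next
      fix p
      assume "p \<in> {p \<in> arcs_ends G. ?edge p = e}"
      then have "{fst p, snd p} = {u, v}"
        by (simp add: e case_prod_unfold)
      then show "p \<in> {(u, v), (v, u)}"
        by (cases p) (simp add: doubleton_eq_iff)
    qed
    moreover have "g {v, u} = g e"
      by (simp only: e insert_commute)
    ultimately show ?thesis
      by (simp add: e)
  qed
  have "(\<Sum>p\<in>arcs_ends G. g (?edge p))
      = (\<Sum>e\<in>undirected_edges G. \<Sum>p\<in>{p \<in> arcs_ends G. ?edge p = e}. g (?edge p))"
    unfolding edges by (rule sum.image_gen[OF finite_arcs_ends])
  also have "\<dots> = 2 * (\<Sum>e\<in>undirected_edges G. g e)"
    unfolding sum_distrib_left by (intro sum.cong refl fibre)
  finally show ?thesis
    by (simp add: case_prod_unfold)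
qed

section \<open>The Randic matrix\<close>

lemma sum_squares_randic_spectrum:
  assumes "distinct vs" and vs: "set vs = verts G"
  shows "(\<Sum>\<rho>\<in>#randic_spectrum G vs. \<rho>\<^sup>2) = 2 * general_randic_index (-1) G"
proof -
  let ?R = "randic_matrix G vs" and ?n = "length vs"
  let ?d = "\<lambda>v. real (out_degree G v)"
  define g where "g e = (\<Prod>v\<in>e. ?d v) powr (-1)" for e
  let ?f = "\<lambda>u v. if u \<rightarrow>\<^bsub>G\<^esub> v then g {u, v} else 0"
  have R: "?R \<in> carrier_mat ?n ?n"
    by (simp add: randic_matrix_def)
  have sym: "?R $$ (i, j) = ?R $$ (j, i)" if "i < ?n" "j < ?n" for i j
    using that arcs_ends_symmetric[OF sym_arcs] by (auto simp: randic_matrix_def mult.commute)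
  \<comment> \<open>Without a loop at \<open>vs ! i\<close>, the product over \<open>{vs ! i, vs ! j}\<close> has two factors.\<close>
  have entry: "(?R $$ (i, j))\<^sup>2 = ?f (vs ! i) (vs ! j)" if "i < ?n" "j < ?n" for i j
  proof (cases "vs ! i \<rightarrow>\<^bsub>G\<^esub> vs ! j")
    case True
    then have "vs ! i \<noteq> vs ! j"
      using adj_not_same by auto
    with True that show ?thesis
      by (simp add: randic_matrix_def g_def power_divide powr_minus_divide)
  qed (use that in \<open>simp add: randic_matrix_def\<close>)
  have "(\<Sum>\<rho>\<in>#randic_spectrum G vs. \<rho>\<^sup>2) = (\<Sum>i<?n. \<Sum>j<?n. ?f (vs ! i) (vs ! j))"
    unfolding randic_spectrum_def
    by (subst sum_squares_proots_symmetric[OF R sym]) (simp_all add: entry)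
  also have "\<dots> = (\<Sum>(u, v)\<in>verts G \<times> verts G. ?f u v)"
    unfolding vs[symmetric] by (rule sum_nth_nth_eq_sum_pairs[OF assms(1)])
  also have "\<dots> = (\<Sum>(u, v)\<in>arcs_ends G. g {u, v})"
    by (rule sum.mono_neutral_cong_right) (auto dest: adj_in_verts)
  also have "\<dots> = 2 * general_randic_index (-1) G"
    unfolding sum_arcs_ends_eq_sum_edges by (simp add: general_randic_index_def g_def)
  finally show ?thesis .
qed

lemma general_randic_index_pos:
  assumes "undirected_edges G \<noteq> {}"
  shows "0 < general_randic_index \<beta> G"
  unfolding general_randic_index_def
proof (rule sum_pos)
  have "undirected_edges G = (\<lambda>(u, v). {u, v}) ` arcs_ends G"
    by (auto simp: undirected_edges_def)
  then show "finite (undirected_edges G)"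
    by (simp add: finite_arcs_ends)
next
  fix e
  assume "e \<in> undirected_edges G"
  then obtain u v where uv: "u \<rightarrow>\<^bsub>G\<^esub> v" and e: "e = {u, v}"
    by (auto simp: undirected_edges_def)
  have "(\<Prod>w\<in>e. real (out_degree G w)) > 0"
    using out_degree_pos[OF uv] out_degree_pos[OF arcs_ends_symmetric[OF sym_arcs uv]]
    by (intro prod_pos) (auto simp: e)
  then show "0 < (\<Prod>w\<in>e. real (out_degree G w)) powr \<beta>"
    by simp
qed (use assms in simp)

lemma randic_energy_nonzero:
  assumes "distinct vs" and "set vs = verts G" and "undirected_edges G \<noteq> {}"
  shows "randic_energy G vs \<noteq> 0"
proof
  assume "randic_energy G vs = 0"
  then have zero: "\<forall>\<rho>\<in>#randic_spectrum G vs. \<rho> = 0"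
    unfolding randic_energy_def by (simp add: sum_mset_abs_eq_0_iff)
  have "(\<Sum>\<rho>\<in>#randic_spectrum G vs. \<rho>\<^sup>2) = 0"
    using zero by (intro sum_mset.neutral) auto
  then show False
    using sum_squares_randic_spectrum[OF assms(1,2)] general_randic_index_pos[OF assms(3), of "-1"]
    by simp
qed

end

section \<open>Entropies of the Randic spectrum\<close>

theorem theorem3p11:
  fixes G :: "('a, 'b) pre_digraph" and vs :: "'a list"
    and n m :: nat and b \<alpha> :: real
  assumes "graph G"
    and "distinct vs" and "set vs = verts G"
    and "card (verts G) = n" and "card (undirected_edges G) = m" and "m \<ge> 1"
    and "b > 0" and "b \<noteq> 1" and "\<alpha> \<noteq> 1"
  shows "entropy1 (randic_spectrum G vs)
           = 1 - 2 / (randic_energy G vs)\<^sup>2 * general_randic_index (-1) G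
       \<and> entropy2 b \<alpha> (randic_spectrum G vs)
           = 1 / (1 - \<alpha>) * log b (randic_moment \<alpha> G vs / randic_energy G vs powr \<alpha>)
       \<and> entropy3 \<alpha> (randic_spectrum G vs)
           = 1 / (2 powr (1 - \<alpha>) - 1) * (randic_moment \<alpha> G vs / randic_energy G vs powr \<alpha> - 1)"
proof (intro conjI)
  interpret graph G by fact
  have "undirected_edges G \<noteq> {}"
    using assms(5,6) by auto
  then have "randic_energy G vs \<noteq> 0"
    using randic_energy_nonzero assms(2,3) by blast
  then show "entropy1 (randic_spectrum G vs)
      = 1 - 2 / (randic_energy G vs)\<^sup>2 * general_randic_index (-1) G"
    using entropy1_eq_sum_squares[of "randic_spectrum G vs"]
      sum_squares_randic_spectrum[OF assms(2,3)]
    by (simp add: randic_energy_def)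
qed (simp_all add: entropy2_def entropy3_def sum_entropy_weights_powr
      randic_moment_def randic_energy_def)

end
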